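(* Let $u_k\in E$, let $\alpha_k\ge 0$, and suppose that $\mathcal G$ is Fréchet differentiable at $u_k$ and that there exist $r_1[u_k],\dots,r_M[u_k]\in L^2(D)$ such that $$D\mathcal G_i(u_k)h=\langle r_i[u_k],h\rangle_{L^2(D)}\qquad\text{for all }h\in E,\ i=1,\dots,M.$$ (i) The Levenberg--Marquardt update, i.e. the unique minimiser $h_k\in E$ over $h\in E$ of $$J_k(h)=\tfrac12\|y-\mathcal G(u_k)-D\mathcal G(u_k)h\|_\Sigma^2+\tfrac12\|u_k+h-\bar u\|_E^2+\tfrac{\alpha_k}{2}\|h\|_E^2,$$ is given by $$h_k=\frac{\bar u-u_k}{1+\alpha_k}+\sum_{i=1}^M a_{k,i}\,\mathcal C_0 r_i[u_k],$$ where $a_k=(a_{k,1},\dots,a_{k,M})\in\mathbb R^M$ solves $$\bigl[\mathcal R(u_k)+(1+\alpha_k)\Sigma\bigr]a_k=y-\mathcal G(u_k)-D\mathcal G(u_k)\!\left(\frac{\bar u-u_k}{1+\alpha_k}\right),\qquad [\mathcal R(u_k)]_{ij}=\langle r_i[u_k],\mathcal C_0 r_j[u_k]\rangle_{L^2(D)}.$$ (ii) Let $u_{\mathrm{MAP}}$ be a stationary point of $J_{\mathrm{OM}}$ at which $\mathcal G$ is Fréchet differentiable with $D\mathcal G_i(u_{\mathrm{MAP}})h=\langle r_i[u_{\mathrm{MAP}}],h\rangle_{L^2(D)}$ for all $h\in E$, $i=1,\dots,M$, for some $r_i[u_{\mathrm{MAP}}]\in L^2(D)$. Then the Gauss--Newton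 Hessian covariance $$\mathcal C_{\mathrm{MAP}}:=\mathcal C_0-\mathcal C_0 D\mathcal G(u_{\mathrm{MAP}})^*\bigl(D\mathcal G(u_{\mathrm{MAP}})\mathcal C_0 D\mathcal G(u_{\mathrm{MAP}})^*+\Sigma\bigr)^{-1}D\mathcal G(u_{\mathrm{MAP}})\mathcal C_0$$ admits the finite-rank representation $$\mathcal C_{\mathrm{MAP}}v=\mathcal C_0v-\mathcal C_0\sum_{i,j=1}^M r_i[u_{\mathrm{MAP}}]\,\bigl[\mathcal R(u_{\mathrm{MAP}})+\Sigma\bigr]^{-1}_{ij}\,\langle r_j[u_{\mathrm{MAP}}],\mathcal C_0v\rangle_{L^2(D)},\qquad v\in L^2(D),$$ where $[\mathcal R(u_{\mathrm{MAP}})]_{ij}=\langle r_i[u_{\mathrm{MAP}}],\mathcal C_0 r_j[u_{\mathrm{MAP}}]\rangle_{L^2(D)}$; hence $\mathcal C_{\mathrm{MAP}}$ differs from $\mathcal C_0$ by an operator of rank at most $M$.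
   Context: Setting. $D\subset\mathbb R^d$ is a bounded open domain and $X=C(\overline D)$ with the supremum norm. The prior on the unknown $u$ (a log-permeability field) is the Gaussian measure $\mu_0=\mathcal N(\bar u,\mathcal C_0)$, where $\mathcal C_0=\sigma^2(\varkappa^2I-\Delta)^{-(\nu+d/2)}$ is a Matérn covariance operator (fractional power understood spectrally with appropriate boundary conditions on $D$), $\sigma,\varkappa>0$, $\nu>d/2$. $\mathcal C_0$ is self-adjoint, positive and trace class on $L^2(D)$, and $\mu_0(X)=1$. The Cameron--Martin space is $E=\operatorname{Range}(\mathcal C_0^{1/2})$ with inner product $\langle h_1,h_2\rangle_E=\langle\mathcal C_0^{-1/2}h_1,\mathcal C_0^{-1/2}h_2\rangle_{L^2(D)}$. $E$ is dense in $L^2(D)$ and compactly embedded in $X$. It is assumed that $\bar u\in E$. The forward (parameter-to-observable) map is $\mathcal G=(\mathcal G_1,\dots,\mathcal G_M):X\to\mathbb R^M$, $\mathcal G_i(u)=\int_0^T\int_D\mathcal H_i(x,t)\,p[u](x,t)\,dx\,dt$ with $\mathcal H_i\in L^\infty(D\times(0,T])$, where $p[u]\in L^2(0,T;H^1(D))\cap L^\infty(D\times(0,T])$ is the pressure, extended to $D$, of a single-phase Darcy flow with moving boundary and permeability $e^u$: $-\nabla\cdot(e^u\nabla p)=0$ in the evolving saturated region $\Omega(t)\subseteq D$, whose front $\Upsilon(t)=\partial\Omega(t)\cap D$ moves with normal velocity $-\frac{1}{\mu_f\phi}e^u\nabla p\cdot n$; $p=p_I$ on the inlet part of $\partial D$,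 $p=p_0$ on the outlet part and on $\Upsilon(t)$, $\nabla p\cdot n=0$ on the remaining sealed part; $p(\cdot,0)=p_0$ and $\Upsilon(0)$ is the inlet. Data $y\in\mathbb R^M$; $\Sigma\in\mathbb R^{M\times M}$ is symmetric positive definite, $\|v\|_\Sigma^2:=v^\top\Sigma^{-1}v$. Set $\Phi_y(u)=\frac12\|y-\mathcal G(u)\|_\Sigma^2$. The Onsager--Machlup functional is $J_{\mathrm{OM}}(u)=\Phi_y(u)+\frac12\|u-\bar u\|_E^2$ if $u-\bar u\in E$ and $+\infty$ if $u-\bar u\in X\setminus E$. Fréchet differentiability of $\mathcal G$ at $u\in E$ is with respect to perturbations in $E$, so $D\mathcal G(u):E\to\mathbb R^M$. When $D\mathcal G_i(u)h=\langle r_i[u],h\rangle_{L^2(D)}$ for $h\in E$ with $r_i[u]\in L^2(D)$, $D\mathcal G(u)$ extends uniquely to a bounded operator $L^2(D)\to\mathbb R^M$, still denoted $D\mathcal G(u)$, and $D\mathcal G(u)^*:\mathbb R^M\to L^2(D)$ denotes the adjoint of this extension, $D\mathcal G(u)^*w=\sum_{i=1}^Mw_ir_i[u]$. *)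

theory Defs
  imports "HOL-Probability.Probability"
begin

section \<open>Function spaces on a domain\<close>

text \<open>
  Elements of L2(D) are represented by square-integrable functions; two functions that agree
  almost everywhere on D represent the same element.
\<close>

definition L2 :: "'a::euclidean_space set \<Rightarrow> ('a \<Rightarrow> real) set" where
  "L2 D = {f \<in> borel_measurable (lebesgue_on D). integrable (lebesgue_on D) (\<lambda>x. (f x)\<^sup>2)}"

definition L2_inner :: "'a::euclidean_space set \<Rightarrow> ('a \<Rightarrow> real) \<Rightarrow> ('a \<Rightarrow> real) \<Rightarrow> real" where
  "L2_inner D f g = (LINT x|lebesgue_on D. f x * g x)"

definition L2_norm :: "'a::euclidean_space set \<Rightarrow> ('a \<Rightarrow> real) \<Rightarrow> real" where
  "L2_norm D f = sqrt (L2_inner D f f)"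

definition L2_sums :: "'a::euclidean_space set \<Rightarrow> (nat \<Rightarrow> 'a \<Rightarrow> real) \<Rightarrow> ('a \<Rightarrow> real) \<Rightarrow> bool" where
  "L2_sums D g f \<longleftrightarrow>
     (\<forall>n. g n \<in> L2 D) \<and> f \<in> L2 D \<and>
     (\<lambda>N. L2_norm D (\<lambda>x. (\<Sum>n<N. g n x) - f x)) \<longlonglongrightarrow> 0"

definition Linf :: "'a::euclidean_space set \<Rightarrow> ('a \<Rightarrow> real) set" where
  "Linf D = {f \<in> borel_measurable (lebesgue_on D). \<exists>C. AE x in lebesgue_on D. \<bar>f x\<bar> \<le> C}"

text \<open>
  \<open>CX D\<close> is the space of continuous functions on the closure of D.  Fixing the value 0 off the
  closure makes equality in this space coincide with equality of HOL functions.
\<close>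

definition CX :: "'a::euclidean_space set \<Rightarrow> ('a \<Rightarrow> real) set" where
  "CX D = {u. continuous_on (closure D) u \<and> (\<forall>x. x \<notin> closure D \<longrightarrow> u x = 0)}"

definition orthonormal_basis :: "'a::euclidean_space set \<Rightarrow> (nat \<Rightarrow> 'a \<Rightarrow> real) \<Rightarrow> bool" where
  "orthonormal_basis D e \<longleftrightarrow>
     (\<forall>n. e n \<in> L2 D) \<and>
     (\<forall>m n. L2_inner D (e m) (e n) = (if m = n then 1 else 0)) \<and>
     (\<forall>f\<in>L2 D. L2_sums D (\<lambda>n x. L2_inner D f (e n) * e n x) f)"

primrec cont_diff :: "nat \<Rightarrow> ('a::euclidean_space \<Rightarrow> real) \<Rightarrow> bool" where
  "cont_diff 0 f \<longleftrightarrow> continuous_on UNIV f"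
| "cont_diff (Suc k) f \<longleftrightarrow>
     (\<forall>x. f differentiable at x) \<and> (\<forall>v. cont_diff k (\<lambda>x. frechet_derivative f (at x) v))"

definition smooth :: "('a::euclidean_space \<Rightarrow> real) \<Rightarrow> bool" where
  "smooth f \<longleftrightarrow> (\<forall>k. cont_diff k f)"

definition test_fun :: "'a::euclidean_space set \<Rightarrow> ('a \<Rightarrow> real) \<Rightarrow> bool" where
  "test_fun D \<psi> \<longleftrightarrow> smooth \<psi> \<and> compact (closure {x. \<psi> x \<noteq> 0}) \<and> closure {x. \<psi> x \<noteq> 0} \<subseteq> D"

definition grad :: "(real^'d \<Rightarrow> real) \<Rightarrow> real^'d \<Rightarrow> real^'d" where
  "grad f x = (\<chi> i. frechet_derivative f (at x) (axis i 1))"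

definition laplacian :: "(real^'d \<Rightarrow> real) \<Rightarrow> real^'d \<Rightarrow> real" where
  "laplacian f x =
     (\<Sum>i\<in>UNIV. frechet_derivative (\<lambda>z. frechet_derivative f (at z) (axis i 1)) (at x) (axis i 1))"

text \<open>\<open>f\<close> belongs to the Sobolev space H1(D), with weak gradient \<open>g\<close>.\<close>

definition H1_grad :: "(real^'d) set \<Rightarrow> (real^'d \<Rightarrow> real) \<Rightarrow> (real^'d \<Rightarrow> real^'d) \<Rightarrow> bool" where
  "H1_grad D f g \<longleftrightarrow>
     f \<in> L2 D \<and> (\<forall>i. (\<lambda>x. g x $ i) \<in> L2 D) \<and>
     (\<forall>\<psi> i. test_fun D \<psi> \<longrightarrow>
        L2_inner D f (\<lambda>x. grad \<psi> x $ i) = - L2_inner D (\<lambda>x. g x $ i) \<psi>)"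

definition const_near :: "real \<Rightarrow> 'a::euclidean_space set \<Rightarrow> ('a \<Rightarrow> real) \<Rightarrow> bool" where
  "const_near c K \<psi> \<longleftrightarrow> (\<exists>U. open U \<and> closure K \<subseteq> U \<and> (\<forall>x\<in>U. \<psi> x = c))"

text \<open>
  \<open>f = c\<close> on the boundary part \<open>\<Gamma>\<close> in the trace sense (\<open>g\<close> is the weak gradient of \<open>f\<close>):
  \<open>f\<close> is an H1-limit of smooth functions that equal \<open>c\<close> near \<open>\<Gamma>\<close>.
\<close>

definition trace_const ::
  "(real^'d) set \<Rightarrow> (real^'d) set \<Rightarrow> real \<Rightarrow> (real^'d \<Rightarrow> real) \<Rightarrow> (real^'d \<Rightarrow> real^'d) \<Rightarrow> bool" where
  "trace_const D \<Gamma> c f g \<longleftrightarrow>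
     (\<exists>F. (\<forall>k::nat. smooth (F k) \<and> const_near c \<Gamma> (F k)) \<and>
          (\<lambda>k. L2_norm D (\<lambda>x. F k x - f x)) \<longlonglongrightarrow> 0 \<and>
          (\<forall>i. (\<lambda>k. L2_norm D (\<lambda>x. grad (F k) x $ i - g x $ i)) \<longlonglongrightarrow> 0))"

section \<open>The inverse problem\<close>

text \<open>
  \<open>eigfun\<close> and \<open>eigval\<close> are the spectral data of the self-adjoint realisation of the negative
  Laplacian on L2 of the domain that is singled out by the chosen boundary conditions.
  \<open>pressure\<close> is the map that takes a log-permeability u to the space-time function p[u].
\<close>

record ('d::finite, 'm::finite) problem =
  dom :: "(real^'d) set"
  inlet :: "(real^'d) set"
  outlet :: "(real^'d) set"
  inlet_pressure :: real
  initial_pressure :: real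
  viscosity :: real
  porosity :: real
  final_time :: real
  matern_sigma :: real
  matern_kappa :: real
  matern_nu :: real
  eigfun :: "nat \<Rightarrow> real^'d \<Rightarrow> real"
  eigval :: "nat \<Rightarrow> real"
  prior_mean :: "real^'d \<Rightarrow> real"
  prior :: "(real^'d \<Rightarrow> real) measure"
  sensor :: "'m \<Rightarrow> (real^'d) \<times> real \<Rightarrow> real"
  pressure :: "(real^'d \<Rightarrow> real) \<Rightarrow> (real^'d) \<times> real \<Rightarrow> real"
  observation :: "real^'m"
  noise_cov :: "real^'m^'m"

subsection \<open>Matern covariance and Cameron--Martin space\<close>

definition cov_eigval :: "('d::finite, 'm::finite) problem \<Rightarrow> nat \<Rightarrow> real" where
  "cov_eigval P n = (matern_sigma P)\<^sup>2 *
     ((matern_kappa P)\<^sup>2 + eigval P n) powr (- (matern_nu P + real CARD('d) / 2))"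

text \<open>
  The spectral power of order \<open>\<theta>\<close> of the Matern covariance.  It is only used for orders 1
  and 1/2, where the values lie in the Cameron--Martin space and hence have a (unique) continuous
  representative; this representative is the one that is selected.
\<close>

definition cov_power ::
  "('d::finite, 'm::finite) problem \<Rightarrow> real \<Rightarrow> (real^'d \<Rightarrow> real) \<Rightarrow> real^'d \<Rightarrow> real" where
  "cov_power P \<theta> v = (THE f. f \<in> CX (dom P) \<and>
     L2_sums (dom P)
       (\<lambda>n x. cov_eigval P n powr \<theta> * L2_inner (dom P) v (eigfun P n) * eigfun P n x) f)"

abbreviation C0 :: "('d::finite, 'm::finite) problem \<Rightarrow> (real^'d \<Rightarrow> real) \<Rightarrow> real^'d \<Rightarrow> real" where
  "C0 P \<equiv> cov_power P 1"

abbreviation C0_sqrt :: "('d::finite, 'm::finite) problem \<Rightarrow> (real^'d \<Rightarrow> real) \<Rightarrow> real^'d \<Rightarrow> real" where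
  "C0_sqrt P \<equiv> cov_power P (1 / 2)"

definition CM :: "('d::finite, 'm::finite) problem \<Rightarrow> (real^'d \<Rightarrow> real) set" where
  "CM P = C0_sqrt P ` L2 (dom P)"

text \<open>
  The square root of the covariance is injective modulo equality almost everywhere, so the inner
  product does not depend on the preimages chosen by \<open>inv_into\<close>.
\<close>

definition CM_inner ::
  "('d::finite, 'm::finite) problem \<Rightarrow> (real^'d \<Rightarrow> real) \<Rightarrow> (real^'d \<Rightarrow> real) \<Rightarrow> real" where
  "CM_inner P h1 h2 = L2_inner (dom P)
     (inv_into (L2 (dom P)) (C0_sqrt P) h1) (inv_into (L2 (dom P)) (C0_sqrt P) h2)"

definition CM_norm :: "('d::finite, 'm::finite) problem \<Rightarrow> (real^'d \<Rightarrow> real) \<Rightarrow> real" where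
  "CM_norm P h = sqrt (CM_inner P h h)"

text \<open>
  The Gaussian measure on the continuous functions with given mean and covariance \<open>C0 P\<close>,
  characterised by its Fourier transform.  The sigma-algebra generated by the point evaluations is
  the Borel sigma-algebra of the supremum norm.
\<close>

definition gaussian_prior ::
  "('d::finite, 'm::finite) problem \<Rightarrow> (real^'d \<Rightarrow> real) \<Rightarrow> (real^'d \<Rightarrow> real) measure \<Rightarrow> bool" where
  "gaussian_prior P m \<mu> \<longleftrightarrow>
     prob_space \<mu> \<and> space \<mu> = CX (dom P) \<and>
     sets \<mu> = sigma_sets (CX (dom P))
       {{u \<in> CX (dom P). u x \<in> B} | x B. x \<in> closure (dom P) \<and> B \<in> sets borel} \<and>
     (\<forall>v\<in>L2 (dom P).
        (LINT u|\<mu>. cis (L2_inner (dom P) u v)) =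
        cis (L2_inner (dom P) m v) * exp (- complex_of_real (L2_inner (dom P) v (C0 P v) / 2)))"

subsection \<open>Forward map\<close>

text \<open>
  \<open>p\<close> is the pressure, extended by the constant \<open>initial_pressure\<close> from the saturated region
  \<open>\<Omega> t\<close> to the whole domain, of the moving-boundary Darcy flow with permeability \<open>exp u\<close>.
  As \<open>u\<close> is merely continuous, all equations are understood in the weak sense:

  \<^item> The pressure condition on the moving front is expressed by the extension being in H1 of the
    whole domain for almost every time.
  \<^item> The sealed part (the rest of the boundary) carries a natural boundary condition: test
    functions need not vanish there.
  \<^item> The last clause is the weak form, with nothing saturated at time 0 (the front starts at the
    inlet), of \<open>viscosity * porosity * d/dt 1\<^bsub>\<Omega> t\<^esub> = div (exp u * grad p)\<close>.  Across a
    smooth front with unit normal n and normal velocity V its jump condition is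
    \<open>viscosity * porosity * V = - exp u * grad p \<bullet> n\<close>.
\<close>

definition darcy_pressure ::
  "('d::finite, 'm::finite) problem \<Rightarrow> (real^'d \<Rightarrow> real) \<Rightarrow> ((real^'d) \<times> real \<Rightarrow> real) \<Rightarrow> bool" where
  "darcy_pressure P u p \<longleftrightarrow>
    (let D = dom P; \<Gamma>I = inlet P; \<Gamma>O = outlet P; T = final_time P; Q = D \<times> {0<..T} in
     p \<in> Linf Q \<and>
     (\<exists>(\<Omega> :: real \<Rightarrow> (real^'d) set) (q :: (real^'d) \<times> real \<Rightarrow> real^'d).
        (\<forall>t\<in>{0..T}. open (\<Omega> t) \<and> \<Omega> t \<subseteq> D) \<and>
        {z \<in> Q. fst z \<in> \<Omega> (snd z)} \<in> sets lebesgue \<and>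
        \<Omega> 0 = {} \<and>
        (\<forall>i. (\<lambda>z. q z $ i) \<in> L2 Q) \<and>
        (\<forall>t\<in>{0..T}. AE x in lebesgue_on D. x \<notin> \<Omega> t \<longrightarrow> p (x, t) = initial_pressure P) \<and>
        (AE t in lebesgue_on {0<..T}.
           H1_grad D (\<lambda>x. p (x, t)) (\<lambda>x. q (x, t)) \<and>
           trace_const D \<Gamma>I (inlet_pressure P) (\<lambda>x. p (x, t)) (\<lambda>x. q (x, t)) \<and>
           trace_const D \<Gamma>O (initial_pressure P) (\<lambda>x. p (x, t)) (\<lambda>x. q (x, t)) \<and>
           (\<forall>\<psi>. smooth \<psi> \<longrightarrow> const_near 0 (\<Gamma>I \<union> \<Gamma>O \<union> (frontier (\<Omega> t) \<inter> D)) \<psi> \<longrightarrow>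
              (LINT x|lebesgue_on (\<Omega> t). exp (u x) * (q (x, t) \<bullet> grad \<psi> x)) = 0)) \<and>
        (\<forall>\<psi>. smooth \<psi> \<longrightarrow> const_near 0 ((\<Gamma>I \<union> \<Gamma>O) \<times> {0..T} \<union> D \<times> {T}) \<psi> \<longrightarrow>
           (LINT z|lebesgue_on {z \<in> Q. fst z \<in> \<Omega> (snd z)}.
              viscosity P * porosity P * frechet_derivative \<psi> (at z) (0, 1)) =
           (LINT z|lebesgue_on Q.
              exp (u (fst z)) * (q z \<bullet> grad (\<lambda>x. \<psi> (x, snd z)) (fst z))))))"

definition forward :: "('d::finite, 'm::finite) problem \<Rightarrow> (real^'d \<Rightarrow> real) \<Rightarrow> real^'m" where
  "forward P u = (\<chi> i. LINT t|lebesgue_on {0<..final_time P}. LINT x|lebesgue_on (dom P).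
     sensor P i (x, t) * pressure P u (x, t))"

subsection \<open>Standing assumptions\<close>

text \<open>
  The eigenfunction equation is imposed in the distributional sense; together with the basis
  property it says that the diagonal operator with eigenvalues \<open>eigval P n\<close> is a self-adjoint
  extension of the negative Laplacian on test functions.  Each choice of boundary conditions
  corresponds to one such extension.
\<close>

locale darcy_inverse_problem =
  fixes P :: "('d::finite, 'm::finite) problem"
  assumes domain: "open (dom P)" "connected (dom P)" "bounded (dom P)" "dom P \<noteq> {}"
    and boundary_parts: "inlet P \<subseteq> frontier (dom P)" "outlet P \<subseteq> frontier (dom P)"
      "inlet P \<inter> outlet P = {}"
    and flow_parameters: "viscosity P > 0" "porosity P > 0" "final_time P > 0"
    and matern_parameters: "matern_sigma P > 0" "matern_kappa P > 0"
      "matern_nu P > real CARD('d) / 2"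
    and eigenbasis: "orthonormal_basis (dom P) (eigfun P)"
    and eigenfunctions: "\<And>n \<psi>. test_fun (dom P) \<psi> \<Longrightarrow>
      L2_inner (dom P) (eigfun P n) (\<lambda>x. - laplacian \<psi> x) =
      eigval P n * L2_inner (dom P) (eigfun P n) \<psi>"
    and positive: "\<And>n. (matern_kappa P)\<^sup>2 + eigval P n > 0"
    and trace_class: "summable (cov_eigval P)"
    and embedding: "\<And>v. v \<in> L2 (dom P) \<Longrightarrow> \<exists>f\<in>CX (dom P). L2_sums (dom P)
      (\<lambda>n x. cov_eigval P n powr (1 / 2) * L2_inner (dom P) v (eigfun P n) * eigfun P n x) f"
    and compact_embedding: "\<And>h :: nat \<Rightarrow> real^'d \<Rightarrow> real.
      (\<And>k. h k \<in> CM P) \<Longrightarrow> bounded (range (\<lambda>k. CM_norm P (h k))) \<Longrightarrow>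
      \<exists>\<rho> f. strict_mono \<rho> \<and> f \<in> CX (dom P) \<and>
        uniform_limit (closure (dom P)) (\<lambda>k. h (\<rho> k)) f sequentially"
    and mean: "prior_mean P \<in> CM P"
    and prior: "gaussian_prior P (prior_mean P) (prior P)"
    and sensors: "\<And>i. sensor P i \<in> Linf (dom P \<times> {0<..final_time P})"
    and pressures: "\<And>u. u \<in> CX (dom P) \<Longrightarrow> darcy_pressure P u (pressure P u)"
    and noise: "transpose (noise_cov P) = noise_cov P"
      "\<And>w. w \<noteq> 0 \<Longrightarrow> w \<bullet> (noise_cov P *v w) > 0"

subsection \<open>Objective functionals and derivatives\<close>

definition noise_norm_sq :: "('d::finite, 'm::finite) problem \<Rightarrow> real^'m \<Rightarrow> real" where
  "noise_norm_sq P w = w \<bullet> (matrix_inv (noise_cov P) *v w)"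

definition misfit :: "('d::finite, 'm::finite) problem \<Rightarrow> (real^'d \<Rightarrow> real) \<Rightarrow> real" where
  "misfit P u = noise_norm_sq P (observation P - forward P u) / 2"

definition J_OM :: "('d::finite, 'm::finite) problem \<Rightarrow> (real^'d \<Rightarrow> real) \<Rightarrow> ereal" where
  "J_OM P u =
     (if (\<lambda>x. u x - prior_mean P x) \<in> CM P
      then ereal (misfit P u + (CM_norm P (\<lambda>x. u x - prior_mean P x))\<^sup>2 / 2)
      else \<infinity>)"

text \<open>Frechet derivative at \<open>u\<close> with respect to perturbations in the Cameron--Martin space.\<close>

definition has_CM_derivative ::
  "('d::finite, 'm::finite) problem \<Rightarrow> ((real^'d \<Rightarrow> real) \<Rightarrow> 'b::real_normed_vector) \<Rightarrow>
     (real^'d \<Rightarrow> real) \<Rightarrow> ((real^'d \<Rightarrow> real) \<Rightarrow> 'b) \<Rightarrow> bool" where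
  "has_CM_derivative P F u A \<longleftrightarrow>
     (\<forall>g\<in>CM P. \<forall>h\<in>CM P. \<forall>a b. A (\<lambda>x. a * g x + b * h x) = a *\<^sub>R A g + b *\<^sub>R A h) \<and>
     (\<exists>C. \<forall>h\<in>CM P. norm (A h) \<le> C * CM_norm P h) \<and>
     (\<forall>\<epsilon>>0. \<exists>\<delta>>0. \<forall>h\<in>CM P. CM_norm P h < \<delta> \<longrightarrow>
        norm (F (\<lambda>x. u x + h x) - F u - A h) \<le> \<epsilon> * CM_norm P h)"

definition stationary_OM :: "('d::finite, 'm::finite) problem \<Rightarrow> (real^'d \<Rightarrow> real) \<Rightarrow> bool" where
  "stationary_OM P u \<longleftrightarrow>
     u \<in> CX (dom P) \<and> J_OM P u < \<infinity> \<and>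
     has_CM_derivative P (\<lambda>w. real_of_ereal (J_OM P w)) u (\<lambda>h. 0)"

definition LM_objective ::
  "('d::finite, 'm::finite) problem \<Rightarrow> (real^'d \<Rightarrow> real) \<Rightarrow> ((real^'d \<Rightarrow> real) \<Rightarrow> real^'m) \<Rightarrow>
     real \<Rightarrow> (real^'d \<Rightarrow> real) \<Rightarrow> real" where
  "LM_objective P u A \<alpha> h =
     noise_norm_sq P (observation P - forward P u - A h) / 2 +
     (CM_norm P (\<lambda>x. u x + h x - prior_mean P x))\<^sup>2 / 2 +
     \<alpha> / 2 * (CM_norm P h)\<^sup>2"

definition unique_minimiser_on :: "'a set \<Rightarrow> ('a \<Rightarrow> real) \<Rightarrow> 'a \<Rightarrow> bool" where
  "unique_minimiser_on S F h \<longleftrightarrow>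
     h \<in> S \<and> (\<forall>g\<in>S. F h \<le> F g) \<and> (\<forall>k\<in>S. (\<forall>g\<in>S. F k \<le> F g) \<longrightarrow> k = h)"

definition L2_extension ::
  "('d::finite, 'm::finite) problem \<Rightarrow> ((real^'d \<Rightarrow> real) \<Rightarrow> real^'m) \<Rightarrow>
     (real^'d \<Rightarrow> real) \<Rightarrow> real^'m" where
  "L2_extension P A = (SOME B.
     (\<forall>f\<in>L2 (dom P). \<forall>g\<in>L2 (dom P). \<forall>a b.
        B (\<lambda>x. a * f x + b * g x) = a *\<^sub>R B f + b *\<^sub>R B g) \<and>
     (\<exists>C. \<forall>f\<in>L2 (dom P). norm (B f) \<le> C * L2_norm (dom P) f) \<and>
     (\<forall>h\<in>CM P. B h = A h))"

definition L2_adjoint ::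
  "('d::finite, 'm::finite) problem \<Rightarrow> ((real^'d \<Rightarrow> real) \<Rightarrow> real^'m) \<Rightarrow>
     real^'m \<Rightarrow> real^'d \<Rightarrow> real" where
  "L2_adjoint P B = (SOME B'. \<forall>w. B' w \<in> L2 (dom P) \<and>
     (\<forall>v\<in>L2 (dom P). L2_inner (dom P) (B' w) v = w \<bullet> B v))"

definition Rmat :: "('d::finite, 'm::finite) problem \<Rightarrow> ('m \<Rightarrow> real^'d \<Rightarrow> real) \<Rightarrow> real^'m^'m" where
  "Rmat P r = (\<chi> i j. L2_inner (dom P) (r i) (C0 P (r j)))"

text \<open>
  The data-space operator \<open>DG C0 DG* + \<Sigma>\<close> and the Gauss--Newton Hessian covariance, where \<open>A\<close> is
  the derivative of the forward map on the Cameron--Martin space.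
\<close>

definition GN_data_op ::
  "('d::finite, 'm::finite) problem \<Rightarrow> ((real^'d \<Rightarrow> real) \<Rightarrow> real^'m) \<Rightarrow> real^'m \<Rightarrow> real^'m" where
  "GN_data_op P A w =
     (let DG = L2_extension P A in DG (C0 P (L2_adjoint P DG w)) + noise_cov P *v w)"

definition C_MAP ::
  "('d::finite, 'm::finite) problem \<Rightarrow> ((real^'d \<Rightarrow> real) \<Rightarrow> real^'m) \<Rightarrow>
     (real^'d \<Rightarrow> real) \<Rightarrow> real^'d \<Rightarrow> real" where
  "C_MAP P A v =
     (let DG = L2_extension P A in
      (\<lambda>x. C0 P v x - C0 P (L2_adjoint P DG (inv (GN_data_op P A) (DG (C0 P v)))) x))"

definition L2_rank_le ::
  "'a::euclidean_space set \<Rightarrow> nat \<Rightarrow> (('a \<Rightarrow> real) \<Rightarrow> 'a \<Rightarrow> real) \<Rightarrow> bool" where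
  "L2_rank_le D n T \<longleftrightarrow>
     (\<exists>g. (\<forall>k<n. g k \<in> L2 D) \<and>
          (\<forall>v\<in>L2 D. \<exists>c. AE x in lebesgue_on D. T v x = (\<Sum>k<n. c k * g k x)))"

end

theory Submission
  imports Defs
begin

text \<open>
  Write \<open>S\<close> for the square root of the covariance.  It is linear, self-adjoint and injective modulo
  null sets, and \<open>C0 = S S\<close>.  All this is read off from the coefficients with respect to the
  eigenfunctions, since a continuous function is determined by them (\<open>CX_eqI\<close>).  Elements of the
  Cameron--Martin space are the \<open>S w\<close>, with \<open>\<langle>S v, S w\<rangle>\<close> in that space equal to \<open>\<langle>v, w\<rangle>\<close> in L2.  So
  self-adjointness of \<open>S\<close> gives \<open>\<langle>C0 v, h\<rangle> = \<langle>v, h\<rangle>\<close> with the Cameron--Martin inner product on the left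
  and the L2 one on the right (\<open>CM_inner_C0\<close>): \<open>C0 r\<close> is the Riesz representative of the functional
  \<open>\<langle>r, \<cdot>\<rangle>\<close>.

  For the Levenberg--Marquardt step, the linear system for \<open>a\<close> says that the residual at the step is
  \<open>(1 + \<alpha>) \<Sigma> a\<close>.  Its contribution to the first variation is cancelled, through the Riesz
  representation, by that of the two penalties, so the objective is its value at the step plus a
  positive definite quadratic form (\<open>LM_objective_around_step\<close>).  The system is solvable because
  \<open>Rmat\<close> is a Gram matrix, hence positive semidefinite, and the noise covariance is positive definite
  (\<open>Rmat_noise_invertible\<close>).

  For the Gauss--Newton covariance, the Cameron--Martin space is dense in L2, so the extension of the
  derivative to L2 can only be the pairing with the \<open>r i\<close> (\<open>L2_extension_nth\<close>), and its adjoint is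
  \<open>w \<mapsto> \<Sum>i. w i r i\<close> up to null sets, which \<open>C0\<close> does not see.  Then the operator on the data space is
  multiplication by the invertible matrix \<open>Rmat + \<Sigma>\<close> (\<open>GN_data_op_eq\<close>), and the representation and the
  rank bound follow by inserting this into the definition.
\<close>

section \<open>Square-integrable functions\<close>

lemma L2_measurable: "f \<in> L2 D \<Longrightarrow> f \<in> borel_measurable (lebesgue_on D)"
  by (simp add: L2_def)

lemma L2_integrable_mult:
  assumes "f \<in> L2 D" "g \<in> L2 D"
  shows "integrable (lebesgue_on D) (\<lambda>x. f x * g x)"
proof (rule Bochner_Integration.integrable_bound)
  show "integrable (lebesgue_on D) (\<lambda>x. (f x)\<^sup>2 + (g x)\<^sup>2)"
    using assms by (simp add: L2_def)
  show "(\<lambda>x. f x * g x) \<in> borel_measurable (lebesgue_on D)"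
    using assms by (auto dest!: L2_measurable)
  have "\<bar>a * b\<bar> \<le> a\<^sup>2 + b\<^sup>2" for a b :: real
  proof -
    have "2 * (\<bar>a\<bar> * \<bar>b\<bar>) \<le> \<bar>a\<bar>\<^sup>2 + \<bar>b\<bar>\<^sup>2"
      using sum_squares_bound[of "\<bar>a\<bar>" "\<bar>b\<bar>"] by simp
    moreover have "0 \<le> \<bar>a\<bar> * \<bar>b\<bar>"
      by simp
    ultimately show ?thesis
      unfolding abs_mult power2_abs by linarith
  qed
  then show "AE x in lebesgue_on D. norm (f x * g x) \<le> norm ((f x)\<^sup>2 + (g x)\<^sup>2)"
    by simp
qed

lemma L2_lincomb:
  assumes "f \<in> L2 D" "g \<in> L2 D"
  shows "(\<lambda>x. a * f x + b * g x) \<in> L2 D"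
proof -
  have "integrable (lebesgue_on D)
      (\<lambda>x. a\<^sup>2 * (f x * f x) + 2 * a * b * (f x * g x) + b\<^sup>2 * (g x * g x))"
    using assms by (intro Bochner_Integration.integrable_add integrable_mult_right L2_integrable_mult)
  then have "integrable (lebesgue_on D) (\<lambda>x. (a * f x + b * g x)\<^sup>2)"
    by (simp add: power2_eq_square algebra_simps)
  moreover have "(\<lambda>x. a * f x + b * g x) \<in> borel_measurable (lebesgue_on D)"
    using assms by (auto dest!: L2_measurable)
  ultimately show ?thesis
    by (simp add: L2_def)
qed

lemma L2_zero: "(\<lambda>x. 0) \<in> L2 D"
  by (simp add: L2_def)

lemma L2_diff: "f \<in> L2 D \<Longrightarrow> g \<in> L2 D \<Longrightarrow> (\<lambda>x. f x - g x) \<in> L2 D"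
  using L2_lincomb[of f D g 1 "-1"] by simp

lemma L2_sum:
  assumes "\<And>i. i \<in> I \<Longrightarrow> f i \<in> L2 D"
  shows "(\<lambda>x. \<Sum>i\<in>I. c i * f i x) \<in> L2 D"
  using assms
proof (induction I rule: infinite_finite_induct)
  case (insert j I)
  then show ?case
    using L2_lincomb[of "f j" D "\<lambda>x. \<Sum>i\<in>I. c i * f i x" "c j" 1] by simp
qed (simp_all add: L2_zero)

lemma L2_inner_commute: "L2_inner D f g = L2_inner D g f"
  by (simp add: L2_inner_def mult.commute)

lemma L2_inner_lincomb_left:
  assumes "f \<in> L2 D" "g \<in> L2 D" "h \<in> L2 D"
  shows "L2_inner D (\<lambda>x. a * f x + b * g x) h = a * L2_inner D f h + b * L2_inner D g h"
proof -
  have "L2_inner D (\<lambda>x. a * f x + b * g x) h =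
      (LINT x|lebesgue_on D. a * (f x * h x) + b * (g x * h x))"
    by (simp add: L2_inner_def algebra_simps)
  also have "\<dots> = a * L2_inner D f h + b * L2_inner D g h"
    using L2_integrable_mult[OF assms(1,3)] L2_integrable_mult[OF assms(2,3)]
    by (simp add: L2_inner_def)
  finally show ?thesis .
qed

lemma L2_inner_lincomb_right:
  assumes "f \<in> L2 D" "g \<in> L2 D" "h \<in> L2 D"
  shows "L2_inner D h (\<lambda>x. a * f x + b * g x) = a * L2_inner D h f + b * L2_inner D h g"
  using L2_inner_lincomb_left[OF assms] by (simp add: L2_inner_commute)

lemma L2_inner_cmult_left: "f \<in> L2 D \<Longrightarrow> h \<in> L2 D \<Longrightarrow>
    L2_inner D (\<lambda>x. a * f x) h = a * L2_inner D f h"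
  using L2_inner_lincomb_left[of f D f h a 0] by simp

lemma L2_inner_diff_left: "f \<in> L2 D \<Longrightarrow> g \<in> L2 D \<Longrightarrow> h \<in> L2 D \<Longrightarrow>
    L2_inner D (\<lambda>x. f x - g x) h = L2_inner D f h - L2_inner D g h"
  using L2_inner_lincomb_left[of f D g h 1 "-1"] by simp

lemma L2_inner_sum_left:
  assumes "\<And>i. i \<in> I \<Longrightarrow> f i \<in> L2 D" "h \<in> L2 D"
  shows "L2_inner D (\<lambda>x. \<Sum>i\<in>I. c i * f i x) h = (\<Sum>i\<in>I. c i * L2_inner D (f i) h)"
  using assms
proof (induction I rule: infinite_finite_induct)
  case (insert j I)
  then show ?case
    using L2_inner_lincomb_left[of "f j" D "\<lambda>x. \<Sum>i\<in>I. c i * f i x" h "c j" 1]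
    by (simp add: L2_sum)
qed (simp_all add: L2_inner_def)

lemma L2_inner_self_nonneg: "0 \<le> L2_inner D f f"
  by (simp add: L2_inner_def)

lemma L2_norm_nonneg: "0 \<le> L2_norm D f"
  by (simp add: L2_norm_def L2_inner_self_nonneg)

lemma L2_inner_self_eq_0_iff:
  assumes "f \<in> L2 D"
  shows "L2_inner D f f = 0 \<longleftrightarrow> (AE x in lebesgue_on D. f x = 0)"
  using integral_nonneg_eq_0_iff_AE[OF L2_integrable_mult[OF assms assms]]
  by (simp add: L2_inner_def)

lemma L2_inner_cong_AE:
  assumes "AE x in lebesgue_on D. f x = g x" "f \<in> L2 D" "g \<in> L2 D" "h \<in> L2 D"
  shows "L2_inner D f h = L2_inner D g h"
  unfolding L2_inner_def
proof (rule integral_cong_AE)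
  show "(\<lambda>x. f x * h x) \<in> borel_measurable (lebesgue_on D)"
    "(\<lambda>x. g x * h x) \<in> borel_measurable (lebesgue_on D)"
    using assms(2-4) by (auto dest!: L2_measurable)
  show "AE x in lebesgue_on D. f x * h x = g x * h x"
    using assms(1) by (rule eventually_mono) simp
qed

lemma L2_norm_cong_AE:
  assumes "AE x in lebesgue_on D. f x = g x" "f \<in> L2 D" "g \<in> L2 D"
  shows "L2_norm D f = L2_norm D g"
  using L2_inner_cong_AE[OF assms assms(2)] L2_inner_cong_AE[OF assms assms(3)]
  by (simp add: L2_norm_def L2_inner_commute)

lemma L2_Cauchy_Schwarz:
  assumes f: "f \<in> L2 D" and g: "g \<in> L2 D"
  shows "\<bar>L2_inner D f g\<bar> \<le> L2_norm D f * L2_norm D g"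
proof -
  let ?a = "L2_inner D f f" and ?b = "L2_inner D f g" and ?c = "L2_inner D g g"
  have quadratic: "0 \<le> s\<^sup>2 * ?a + 2 * s * t * ?b + t\<^sup>2 * ?c" for s t
  proof -
    let ?h = "\<lambda>x. s * f x + t * g x"
    have "L2_inner D ?h ?h = s * L2_inner D f ?h + t * L2_inner D g ?h"
      using f g by (intro L2_inner_lincomb_left L2_lincomb)
    also have "\<dots> = s\<^sup>2 * ?a + 2 * s * t * ?b + t\<^sup>2 * ?c"
      using f g by (simp add: L2_inner_lincomb_right L2_inner_commute[of D g f]
          power2_eq_square algebra_simps)
    finally show ?thesis
      using L2_inner_self_nonneg[of D ?h] by simp
  qed
  have "?b\<^sup>2 \<le> ?a * ?c"
  proof (cases "?c = 0")
    case True
    have "?b = 0"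
    proof (rule ccontr)
      assume "?b \<noteq> 0"
      \<comment> \<open>With \<open>?c = 0\<close> the form is affine in \<open>t\<close>; this \<open>t\<close> makes it equal to \<open>-1\<close>.\<close>
      then show False
        using quadratic[of 1 "- (?a + 1) / (2 * ?b)"] True by (simp add: field_simps)
    qed
    then show ?thesis
      using True by simp
  next
    case False
    then have "0 < ?c"
      using L2_inner_self_nonneg[of D g] by linarith
    moreover have "0 \<le> ?c * (?a * ?c - ?b\<^sup>2)"
      using quadratic[of ?c "- ?b"] by (simp add: power2_eq_square algebra_simps)
    ultimately show ?thesis
      by (simp add: zero_le_mult_iff)
  qed
  then have "\<bar>?b\<bar> \<le> sqrt (?a * ?c)"
    by (simp add: real_le_rsqrt abs_le_square_iff)
  then show ?thesis
    by (simp add: L2_norm_def real_sqrt_mult)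
qed

text \<open>Convergence in norm implies weak convergence, by the Cauchy--Schwarz inequality.  Identities
  for infinite expansions thereby become identities for real series.\<close>

lemma L2_sums_inner:
  assumes "L2_sums D g f" "w \<in> L2 D"
  shows "(\<lambda>n. L2_inner D (g n) w) sums L2_inner D f w"
proof -
  let ?p = "\<lambda>N x. \<Sum>n<N. g n x"
  have g: "\<And>n. g n \<in> L2 D" and f: "f \<in> L2 D"
    and lim: "(\<lambda>N. L2_norm D (\<lambda>x. ?p N x - f x)) \<longlonglongrightarrow> 0"
    using assms(1) by (auto simp: L2_sums_def)
  have p: "?p N \<in> L2 D" for N
    using L2_sum[of "{..<N}" g D "\<lambda>_. 1"] g by simp
  have diff: "L2_inner D (?p N) w - L2_inner D f w = L2_inner D (\<lambda>x. ?p N x - f x) w" for N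
    using L2_inner_diff_left[OF p f assms(2)] by simp
  have "(\<lambda>N. L2_inner D (?p N) w - L2_inner D f w) \<longlonglongrightarrow> 0"
  proof (rule tendsto_0_le[where K = "L2_norm D w"])
    show "(\<lambda>N. L2_norm D (\<lambda>x. ?p N x - f x)) \<longlonglongrightarrow> 0"
      by (rule lim)
    show "\<forall>\<^sub>F N in sequentially. norm (L2_inner D (?p N) w - L2_inner D f w)
        \<le> norm (L2_norm D (\<lambda>x. ?p N x - f x)) * L2_norm D w"
      unfolding diff
      using L2_Cauchy_Schwarz[OF L2_diff[OF p f] assms(2)] by (simp add: L2_norm_nonneg)
  qed
  then have "(\<lambda>N. L2_inner D (?p N) w) \<longlonglongrightarrow> L2_inner D f w"
    by (rule LIM_zero_cancel)
  moreover have "L2_inner D (?p N) w = (\<Sum>n<N. L2_inner D (g n) w)" for N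
    using L2_inner_sum_left[of "{..<N}" g D w "\<lambda>_. 1"] g assms(2) by simp
  ultimately show ?thesis
    by (simp add: sums_def)
qed

lemma L2_sums_unique:
  assumes "L2_sums D g f" "L2_sums D g f'"
  shows "AE x in lebesgue_on D. f x = f' x"
proof -
  have f: "f \<in> L2 D" "f' \<in> L2 D"
    using assms by (auto simp: L2_sums_def)
  let ?w = "\<lambda>x. f x - f' x"
  have w: "?w \<in> L2 D"
    using f by (rule L2_diff)
  have "L2_inner D f ?w = L2_inner D f' ?w"
    using assms[THEN L2_sums_inner, OF w] by (rule sums_unique2)
  then have "L2_inner D ?w ?w = 0"
    using L2_inner_diff_left[OF f w] by simp
  then show ?thesis
    using L2_inner_self_eq_0_iff[OF w] by simp
qed

text \<open>Inner products may be taken term by term, and orthonormality leaves a single term.\<close>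

lemma orthonormal_basis_coefficient:
  assumes "orthonormal_basis D e" "L2_sums D (\<lambda>n x. c n * e n x) f"
  shows "L2_inner D f (e m) = c m"
proof -
  have e: "\<And>n. e n \<in> L2 D" "\<And>n. L2_inner D (e n) (e m) = (if n = m then 1 else 0)"
    using assms(1) by (auto simp: orthonormal_basis_def)
  have "(\<lambda>n. L2_inner D (\<lambda>x. c n * e n x) (e m)) sums L2_inner D f (e m)"
    using assms(2) e(1) by (rule L2_sums_inner)
  then have "(\<lambda>n. if n = m then c n else 0) sums L2_inner D f (e m)"
    by (simp add: L2_inner_cmult_left e if_distrib[of "(*) (c _)"] cong: if_cong)
  then show ?thesis
    using sums_single[of m c] by (rule sums_unique2)
qed

lemma orthonormal_basis_eqI:
  assumes "orthonormal_basis D e" "f \<in> L2 D" "g \<in> L2 D"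
    and "\<And>n. L2_inner D f (e n) = L2_inner D g (e n)"
  shows "AE x in lebesgue_on D. f x = g x"
proof -
  have "L2_sums D (\<lambda>n x. L2_inner D f (e n) * e n x) f"
    "L2_sums D (\<lambda>n x. L2_inner D f (e n) * e n x) g"
    using assms by (auto simp: orthonormal_basis_def)
  then show ?thesis
    by (rule L2_sums_unique)
qed

section \<open>Continuous representatives\<close>

lemma CX_lincomb:
  assumes "f \<in> CX D" "g \<in> CX D"
  shows "(\<lambda>x. a * f x + b * g x) \<in> CX D"
  using assms by (auto simp: CX_def intro!: continuous_intros)

lemma CX_subset_L2:
  fixes D :: "'a::euclidean_space set"
  assumes "open D" "bounded D"
  shows "CX D \<subseteq> L2 D"
proof
  fix f assume "f \<in> CX D"
  then have cont: "continuous_on (closure D) f"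
    by (simp add: CX_def)
  have lmeas: "D \<in> lmeasurable"
    using assms by (simp add: lmeasurable_open)
  interpret finite_measure "lebesgue_on D"
    using lmeas by (rule finite_measure_lebesgue_on)
  have meas: "f \<in> borel_measurable (lebesgue_on D)"
    using cont closure_subset lmeas
    by (intro continuous_imp_measurable_on_sets_lebesgue) (auto intro: continuous_on_subset)
  have "bounded (f ` closure D)"
    using cont assms(2) by (intro compact_imp_bounded compact_continuous_image) auto
  then obtain B where B: "\<And>x. x \<in> closure D \<Longrightarrow> \<bar>f x\<bar> \<le> B"
    by (auto simp: bounded_iff)
  have "integrable (lebesgue_on D) (\<lambda>x. (f x)\<^sup>2)"
  proof (rule integrable_const_bound)
    have "norm ((f x)\<^sup>2) \<le> B\<^sup>2" if "x \<in> D" for x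
      using B[of x] that closure_subset[of D] power_mono[of "\<bar>f x\<bar>" B 2] by auto
    then show "AE x in lebesgue_on D. norm ((f x)\<^sup>2) \<le> B\<^sup>2"
      by (intro AE_I2) simp
  qed (use meas in simp)
  with meas show "f \<in> L2 D"
    by (simp add: L2_def)
qed

text \<open>The set on which two continuous functions differ is open in \<open>D\<close>, and a nonempty open set
  is not negligible; so a class in L2 has at most one continuous representative.\<close>

lemma CX_eqI_AE:
  fixes D :: "'a::euclidean_space set"
  assumes "open D" and f: "f \<in> CX D" and g: "g \<in> CX D"
    and AE: "AE x in lebesgue_on D. f x = g x"
  shows "f = g"
proof -
  have cont: "continuous_on (closure D) (\<lambda>x. f x - g x)"
    using f g by (auto simp: CX_def intro!: continuous_intros)
  let ?U = "{x \<in> D. f x - g x \<in> - {0}}"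
  have "open ?U"
    using continuous_on_subset[OF cont closure_subset] assms(1)
      continuous_open_preimage[of D "\<lambda>x. f x - g x" "- {0}"]
    by (simp add: vimage_def Int_def open_Compl)
  moreover have "negligible ?U"
  proof -
    have "AE x in lebesgue. x \<in> D \<longrightarrow> f x = g x"
      using AE assms(1) by (simp add: AE_restrict_space_iff)
    then have "{x. \<not> (x \<in> D \<longrightarrow> f x = g x)} \<in> null_sets lebesgue"
      by (simp add: completion.AE_iff_null_sets)
    then show ?thesis
      by (simp add: negligible_iff_null_sets)
  qed
  ultimately have "?U = {}"
    using open_not_negligible by blast
  then have D: "f x - g x = 0" if "x \<in> D" for x
    using that by auto
  have "f x = g x" for x
  proof (cases "x \<in> closure D")
    case True
    then show ?thesis
      using continuous_constant_on_closure[OF cont D] by simp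
  next
    case False
    then show ?thesis
      using f g by (simp add: CX_def)
  qed
  then show ?thesis
    by blast
qed

section \<open>Positive definite matrices\<close>

lemma invertible_posdef:
  fixes A :: "real^'n^'n"
  assumes "\<And>w. w \<noteq> 0 \<Longrightarrow> 0 < w \<bullet> (A *v w)"
  shows "invertible A"
proof -
  have "w = 0" if "A *v w = 0" for w
    using assms[of w] that by fastforce
  then show ?thesis
    by (simp add: invertible_left_inverse matrix_left_invertible_ker)
qed

lemma matrix_inv_vector_mult:
  fixes A :: "real^'n^'n"
  assumes "invertible A"
  shows "matrix_inv A *v (A *v w) = w" "A *v (matrix_inv A *v w) = w"
proof -
  have "A ** matrix_inv A = mat 1 \<and> matrix_inv A ** A = mat 1"
    using assms unfolding invertible_def matrix_inv_def by (rule someI_ex)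
  then show "matrix_inv A *v (A *v w) = w" "A *v (matrix_inv A *v w) = w"
    by (simp_all add: matrix_vector_mul_assoc)
qed

lemma inner_symmetric_matrix:
  fixes A :: "real^'n^'n"
  assumes "transpose A = A"
  shows "v \<bullet> (A *v w) = (A *v v) \<bullet> w"
  using dot_lmul_matrix[of v A w] assms
  by (metis transpose_matrix_vector)

section \<open>The covariance and its square root\<close>

context darcy_inverse_problem
begin

abbreviation D :: "(real^'d) set" where "D \<equiv> dom P"
abbreviation e :: "nat \<Rightarrow> real^'d \<Rightarrow> real" where "e \<equiv> eigfun P"
abbreviation S :: "(real^'d \<Rightarrow> real) \<Rightarrow> real^'d \<Rightarrow> real" where "S \<equiv> C0_sqrt P"

lemma CX_L2: "f \<in> CX D \<Longrightarrow> f \<in> L2 D"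
  using CX_subset_L2 domain by blast

lemma e_L2: "e n \<in> L2 D"
  using eigenbasis by (simp add: orthonormal_basis_def)

lemma cov_eigval_pos: "0 < cov_eigval P n"
  using positive[of n] matern_parameters by (simp add: cov_eigval_def)

lemma CX_eqI:
  assumes "f \<in> CX D" "g \<in> CX D" "\<And>n. L2_inner D f (e n) = L2_inner D g (e n)"
  shows "f = g"
  using assms domain(1) eigenbasis by (intro CX_eqI_AE orthonormal_basis_eqI) (auto intro: CX_L2)

lemma cov_power_eqI:
  assumes "f \<in> CX D"
    and "L2_sums D (\<lambda>n x. cov_eigval P n powr \<theta> * L2_inner D v (e n) * e n x) f"
  shows "cov_power P \<theta> v = f"
  unfolding cov_power_def
proof (rule the_equality)
  show "f \<in> CX D \<and> L2_sums D (\<lambda>n x. cov_eigval P n powr \<theta> * L2_inner D v (e n) * e n x) f"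
    using assms by blast
next
  fix f'
  assume f': "f' \<in> CX D \<and>
    L2_sums D (\<lambda>n x. cov_eigval P n powr \<theta> * L2_inner D v (e n) * e n x) f'"
  then show "f' = f"
    using assms domain(1) by (intro CX_eqI_AE L2_sums_unique) auto
qed

lemma
  assumes "v \<in> L2 D"
  shows S_CX: "S v \<in> CX D"
    and S_sums: "L2_sums D (\<lambda>n x. cov_eigval P n powr (1 / 2) * L2_inner D v (e n) * e n x) (S v)"
proof -
  obtain f where "f \<in> CX D"
    "L2_sums D (\<lambda>n x. cov_eigval P n powr (1 / 2) * L2_inner D v (e n) * e n x) f"
    using embedding[OF assms] by blast
  with cov_power_eqI[OF this] show "S v \<in> CX D"
    "L2_sums D (\<lambda>n x. cov_eigval P n powr (1 / 2) * L2_inner D v (e n) * e n x) (S v)"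
    by simp_all
qed

lemma S_L2: "v \<in> L2 D \<Longrightarrow> S v \<in> L2 D"
  by (simp add: S_CX CX_L2)

lemma S_coefficient:
  "v \<in> L2 D \<Longrightarrow> L2_inner D (S v) (e n) = cov_eigval P n powr (1 / 2) * L2_inner D v (e n)"
  using orthonormal_basis_coefficient[OF eigenbasis S_sums] .

text \<open>The embedding hypothesis provides continuous values for the square root only.  Squaring
  the symbol shows that the covariance is its square, and hence has continuous values as well.\<close>

lemma C0_eq_S_S:
  assumes "v \<in> L2 D"
  shows "C0 P v = S (S v)"
proof (rule cov_power_eqI)
  show "S (S v) \<in> CX D"
    using assms by (intro S_CX S_L2)
  have coefficient: "cov_eigval P n powr 1 * L2_inner D v (e n) =
      cov_eigval P n powr (1 / 2) * L2_inner D (S v) (e n)" for n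
    using cov_eigval_pos[of n] by (simp add: S_coefficient[OF assms] powr_half_sqrt)
  show "L2_sums D (\<lambda>n x. cov_eigval P n powr 1 * L2_inner D v (e n) * e n x) (S (S v))"
    unfolding coefficient by (rule S_sums[OF S_L2[OF assms]])
qed

lemma S_lincomb:
  assumes "v \<in> L2 D" "w \<in> L2 D"
  shows "S (\<lambda>x. a * v x + b * w x) = (\<lambda>x. a * S v x + b * S w x)"
proof (rule CX_eqI)
  show "S (\<lambda>x. a * v x + b * w x) \<in> CX D" "(\<lambda>x. a * S v x + b * S w x) \<in> CX D"
    using assms by (auto intro: S_CX CX_lincomb L2_lincomb)
  show "L2_inner D (S (\<lambda>x. a * v x + b * w x)) (e n) =
      L2_inner D (\<lambda>x. a * S v x + b * S w x) (e n)" for n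
    using assms
    by (simp add: S_coefficient L2_lincomb L2_inner_lincomb_left S_L2 e_L2 algebra_simps)
qed

lemma S_cong_AE:
  assumes "AE x in lebesgue_on D. v x = w x" "v \<in> L2 D" "w \<in> L2 D"
  shows "S v = S w"
  using assms(2,3) L2_inner_cong_AE[OF assms e_L2]
  by (intro CX_eqI) (simp_all add: S_CX S_coefficient)

lemma S_inj_AE:
  assumes "S v = S w" "v \<in> L2 D" "w \<in> L2 D"
  shows "AE x in lebesgue_on D. v x = w x"
proof (rule orthonormal_basis_eqI[OF eigenbasis assms(2,3)])
  fix n
  have "cov_eigval P n powr (1 / 2) \<noteq> 0"
    using cov_eigval_pos[of n] by simp
  then show "L2_inner D v (e n) = L2_inner D w (e n)"
    using S_coefficient[OF assms(2), of n] S_coefficient[OF assms(3), of n] assms(1) by simp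
qed

text \<open>Expanding \<open>S v\<close> against \<open>w\<close> gives a series that is symmetric in \<open>v\<close> and \<open>w\<close>.\<close>

lemma S_selfadjoint:
  assumes "v \<in> L2 D" "w \<in> L2 D"
  shows "L2_inner D (S v) w = L2_inner D v (S w)"
proof -
  have expand: "(\<lambda>n. cov_eigval P n powr (1 / 2) * (L2_inner D f (e n) * L2_inner D g (e n)))
      sums L2_inner D (S f) g" if "f \<in> L2 D" "g \<in> L2 D" for f g
    using L2_sums_inner[OF S_sums[OF that(1)] that(2)]
    unfolding L2_inner_cmult_left[OF e_L2 that(2)] L2_inner_commute[of D "e _" g]
    by (simp only: mult.assoc)
  have "L2_inner D (S v) w = L2_inner D (S w) v"
    using expand[OF assms] expand[OF assms(2,1), unfolded mult.commute[of "L2_inner D w (e _)"]]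
    by (rule sums_unique2)
  then show ?thesis
    by (simp add: L2_inner_commute)
qed

lemma C0_CX: "v \<in> L2 D \<Longrightarrow> C0 P v \<in> CX D"
  by (simp add: C0_eq_S_S S_CX S_L2)

lemma C0_L2: "v \<in> L2 D \<Longrightarrow> C0 P v \<in> L2 D"
  by (simp add: C0_CX CX_L2)

lemma C0_lincomb:
  "v \<in> L2 D \<Longrightarrow> w \<in> L2 D \<Longrightarrow>
    C0 P (\<lambda>x. a * v x + b * w x) = (\<lambda>x. a * C0 P v x + b * C0 P w x)"
  by (simp add: C0_eq_S_S S_lincomb S_L2 L2_lincomb)

lemma C0_sum:
  assumes "finite I" "\<And>i. i \<in> I \<Longrightarrow> f i \<in> L2 D"
  shows "C0 P (\<lambda>x. \<Sum>i\<in>I. c i * f i x) = (\<lambda>x. \<Sum>i\<in>I. c i * C0 P (f i) x)"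
  using assms
proof (induction I rule: finite_induct)
  case empty
  show ?case
    using C0_lincomb[OF L2_zero L2_zero, of 0 0] by simp
next
  case (insert j I)
  then show ?case
    using C0_lincomb[of "f j" "\<lambda>x. \<Sum>i\<in>I. c i * f i x" "c j" 1] by (simp add: L2_sum)
qed

lemma C0_cong_AE:
  assumes "AE x in lebesgue_on D. v x = w x" "v \<in> L2 D" "w \<in> L2 D"
  shows "C0 P v = C0 P w"
  using assms by (simp add: C0_eq_S_S S_cong_AE[OF assms])

lemma C0_nonneg:
  assumes "v \<in> L2 D"
  shows "0 \<le> L2_inner D v (C0 P v)"
  using S_selfadjoint[OF assms S_L2[OF assms]] L2_inner_self_nonneg[of D "S v"]
  by (simp add: C0_eq_S_S assms)

section \<open>The Cameron--Martin space\<close>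

lemma CM_CX: "h \<in> CM P \<Longrightarrow> h \<in> CX D"
  by (auto simp: CM_def S_CX)

lemma CM_L2: "h \<in> CM P \<Longrightarrow> h \<in> L2 D"
  by (simp add: CM_CX CX_L2)

lemma S_CM: "v \<in> L2 D \<Longrightarrow> S v \<in> CM P"
  by (simp add: CM_def)

lemma C0_CM: "v \<in> L2 D \<Longrightarrow> C0 P v \<in> CM P"
  by (simp add: C0_eq_S_S S_CM S_L2)

lemma CM_lincomb:
  assumes "g \<in> CM P" "h \<in> CM P"
  shows "(\<lambda>x. a * g x + b * h x) \<in> CM P"
proof -
  obtain v w where "v \<in> L2 D" "w \<in> L2 D" "g = S v" "h = S w"
    using assms by (auto simp: CM_def)
  then show ?thesis
    using S_CM[OF L2_lincomb[of v D w a b]] by (simp add: S_lincomb)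
qed

text \<open>The preimage chosen by \<open>inv_into\<close> differs from the given one on a null set only.\<close>

lemma CM_inner_S:
  assumes "v \<in> L2 D" "w \<in> L2 D"
  shows "CM_inner P (S v) (S w) = L2_inner D v w"
proof -
  let ?inv = "\<lambda>v. inv_into (L2 D) S (S v)"
  have inv: "?inv v \<in> L2 D" "AE x in lebesgue_on D. ?inv v x = v x" if "v \<in> L2 D" for v
  proof -
    show "?inv v \<in> L2 D"
      using that by (simp add: inv_into_into)
    moreover have "S (?inv v) = S v"
      using that by (simp add: f_inv_into_f)
    ultimately show "AE x in lebesgue_on D. ?inv v x = v x"
      using that by (simp add: S_inj_AE)
  qed
  have "L2_inner D (?inv v) (?inv w) = L2_inner D v (?inv w)"
    using inv assms by (intro L2_inner_cong_AE) auto
  also have "\<dots> = L2_inner D (?inv w) v"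
    by (rule L2_inner_commute)
  also have "\<dots> = L2_inner D w v"
    using inv assms by (intro L2_inner_cong_AE) auto
  finally show ?thesis
    by (simp add: CM_inner_def L2_inner_commute)
qed

lemma CM_inner_commute: "CM_inner P g h = CM_inner P h g"
  by (simp add: CM_inner_def L2_inner_commute)

lemma CM_inner_lincomb_left:
  assumes "f \<in> CM P" "g \<in> CM P" "h \<in> CM P"
  shows "CM_inner P (\<lambda>x. a * f x + b * g x) h = a * CM_inner P f h + b * CM_inner P g h"
proof -
  obtain u v w where *: "u \<in> L2 D" "v \<in> L2 D" "w \<in> L2 D" "f = S u" "g = S v" "h = S w"
    using assms by (auto simp: CM_def)
  then have "CM_inner P (\<lambda>x. a * f x + b * g x) h =
      CM_inner P (S (\<lambda>x. a * u x + b * v x)) (S w)"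
    by (simp add: S_lincomb)
  also have "\<dots> = a * L2_inner D u w + b * L2_inner D v w"
    using * by (simp add: CM_inner_S L2_lincomb L2_inner_lincomb_left)
  finally show ?thesis
    using * by (simp add: CM_inner_S)
qed

lemma CM_norm_sq: "(CM_norm P h)\<^sup>2 = CM_inner P h h"
  by (simp add: CM_norm_def CM_inner_def L2_inner_self_nonneg)

lemma CM_norm_sq_add:
  assumes "g \<in> CM P" "h \<in> CM P"
  shows "(CM_norm P (\<lambda>x. g x + h x))\<^sup>2 =
    (CM_norm P g)\<^sup>2 + 2 * CM_inner P g h + (CM_norm P h)\<^sup>2"
proof -
  have add: "CM_inner P (\<lambda>x. g x + h x) f = CM_inner P g f + CM_inner P h f" if "f \<in> CM P" for f
    using CM_inner_lincomb_left[OF assms that, of 1 1] by simp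
  have "(\<lambda>x. g x + h x) \<in> CM P"
    using CM_lincomb[OF assms, of 1 1] by simp
  then show ?thesis
    using assms
    by (simp add: CM_norm_sq add CM_inner_commute[of g "\<lambda>x. g x + h x"]
        CM_inner_commute[of h "\<lambda>x. g x + h x"] CM_inner_commute[of h g])
qed

lemma CM_norm_eq_0D:
  assumes "h \<in> CM P" "CM_norm P h = 0"
  shows "h = (\<lambda>x. 0)"
proof -
  obtain v where v: "v \<in> L2 D" "h = S v"
    using assms(1) by (auto simp: CM_def)
  have "L2_inner D v v = 0"
    using CM_norm_sq[of h] assms(2) v by (simp add: CM_inner_S)
  then have "S v = S (\<lambda>x. 0)"
    using v(1) by (intro S_cong_AE) (simp_all add: L2_inner_self_eq_0_iff L2_zero)
  also have "\<dots> = (\<lambda>x. 0)"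
    using S_lincomb[OF L2_zero L2_zero, of 0 0] by simp
  finally show ?thesis
    using v(2) by simp
qed

text \<open>The reason why the Levenberg--Marquardt step involves \<open>C0 (r i)\<close>: an L2 functional \<open>\<langle>v, \<cdot>\<rangle>\<close> restricted to the
  Cameron--Martin space is represented there by \<open>C0 v\<close>.  With \<open>h = S w\<close> it is the identity
  \<open>\<langle>S v, w\<rangle> = \<langle>v, S w\<rangle>\<close>.\<close>

lemma CM_inner_C0:
  assumes "v \<in> L2 D" "h \<in> CM P"
  shows "CM_inner P (C0 P v) h = L2_inner D v h"
proof -
  obtain w where "w \<in> L2 D" "h = S w"
    using assms(2) by (auto simp: CM_def)
  then show ?thesis
    using assms(1) by (simp add: C0_eq_S_S CM_inner_S S_L2 S_selfadjoint)
qed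

text \<open>Partial sums of the eigenfunction expansion lie, up to null sets, in the Cameron--Martin
  space, because no eigenvalue of the covariance vanishes.\<close>

lemma CM_dense:
  assumes f: "f \<in> L2 D"
  obtains p where "\<And>N. p N \<in> CM P" "(\<lambda>N. L2_norm D (\<lambda>x. p N x - f x)) \<longlonglongrightarrow> 0"
proof
  let ?s = "\<lambda>N x. \<Sum>n<N. L2_inner D f (e n) * e n x"
  let ?w = "\<lambda>N x. \<Sum>n<N. cov_eigval P n powr (- (1 / 2)) * L2_inner D f (e n) * e n x"
  have s: "?s N \<in> L2 D" and w: "?w N \<in> L2 D" for N
    by (intro L2_sum e_L2)+
  show CM: "S (?w N) \<in> CM P" for N
    using w by (rule S_CM)
  have orth: "L2_inner D (e n) (e m) = (if n = m then 1 else 0)" for n m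
    using eigenbasis by (simp add: orthonormal_basis_def)
  have "AE x in lebesgue_on D. S (?w N) x = ?s N x" for N
  proof (rule orthonormal_basis_eqI[OF eigenbasis CM_L2[OF CM] s])
    fix m
    have "cov_eigval P m powr (1 / 2) * cov_eigval P m powr (- (1 / 2)) = 1"
      using cov_eigval_pos[of m] by (simp flip: powr_add)
    then show "L2_inner D (S (?w N)) (e m) = L2_inner D (?s N) (e m)"
      by (simp add: S_coefficient w L2_inner_sum_left e_L2 orth mult.assoc[symmetric]
          if_distrib[of "(*) _"] sum.delta cong: if_cong)
  qed
  then have "AE x in lebesgue_on D. S (?w N) x - f x = ?s N x - f x" for N
    by (rule eventually_mono) simp
  then have "L2_norm D (\<lambda>x. S (?w N) x - f x) = L2_norm D (\<lambda>x. ?s N x - f x)" for N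
    using L2_diff[OF CM_L2[OF CM] f] L2_diff[OF s f] by (rule L2_norm_cong_AE)
  moreover have "(\<lambda>N. L2_norm D (\<lambda>x. ?s N x - f x)) \<longlonglongrightarrow> 0"
    using eigenbasis f by (simp add: orthonormal_basis_def L2_sums_def)
  ultimately show "(\<lambda>N. L2_norm D (\<lambda>x. S (?w N) x - f x)) \<longlonglongrightarrow> 0"
    by simp
qed

section \<open>The data space\<close>

lemma noise_invertible: "invertible (noise_cov P)"
  using noise(2) by (rule invertible_posdef)

lemma noise_inv_mult:
  "matrix_inv (noise_cov P) *v (noise_cov P *v w) = w"
  "noise_cov P *v (matrix_inv (noise_cov P) *v w) = w"
  using matrix_inv_vector_mult[OF noise_invertible] by auto

lemma noise_inv_symmetric:
  "v \<bullet> (matrix_inv (noise_cov P) *v w) = (matrix_inv (noise_cov P) *v v) \<bullet> w"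
  using inner_symmetric_matrix[OF noise(1), of "matrix_inv (noise_cov P) *v v"
      "matrix_inv (noise_cov P) *v w"]
  by (simp add: noise_inv_mult)

lemma noise_norm_sq_nonneg: "0 \<le> noise_norm_sq P w"
proof -
  let ?z = "matrix_inv (noise_cov P) *v w"
  have "noise_norm_sq P w = ?z \<bullet> (noise_cov P *v ?z)"
    by (simp add: noise_norm_sq_def noise_inv_mult inner_commute)
  then show ?thesis
    using noise(2)[of ?z] by (cases "?z = 0") auto
qed

lemma noise_norm_sq_diff:
  "noise_norm_sq P (v - w) =
    noise_norm_sq P v - 2 * ((matrix_inv (noise_cov P) *v v) \<bullet> w) + noise_norm_sq P w"
  by (simp add: noise_norm_sq_def matrix_vector_mult_diff_distrib inner_diff_left inner_diff_right
      noise_inv_symmetric[of v w] inner_commute[of w])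

text \<open>\<open>Rmat P r\<close> is the matrix of \<open>A C0 A*\<close>, where \<open>A\<close> pairs with the \<open>r i\<close> and its adjoint is
  \<open>a \<mapsto> \<Sum>i. a i r i\<close>.  The Gram structure makes it positive semidefinite.\<close>

lemma Rmat_mult_nth:
  assumes "\<And>i. r i \<in> L2 D"
  shows "(Rmat P r *v a) $ i = L2_inner D (r i) (C0 P (\<lambda>x. \<Sum>j\<in>UNIV. a $ j * r j x))"
proof -
  have "L2_inner D (\<lambda>x. \<Sum>j\<in>UNIV. a $ j * C0 P (r j) x) (r i) =
      (\<Sum>j\<in>UNIV. a $ j * L2_inner D (C0 P (r j)) (r i))"
    using assms by (intro L2_inner_sum_left C0_L2)
  then show ?thesis
    using assms
    by (simp add: C0_sum Rmat_def matrix_vector_mult_def L2_inner_commute[of D "r i"] mult.commute)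
qed

lemma Rmat_nonneg:
  assumes "\<And>i. r i \<in> L2 D"
  shows "0 \<le> w \<bullet> (Rmat P r *v w)"
proof -
  let ?q = "\<lambda>x. \<Sum>j\<in>UNIV. w $ j * r j x"
  have q: "?q \<in> L2 D"
    using assms by (intro L2_sum)
  have "w \<bullet> (Rmat P r *v w) = (\<Sum>i\<in>UNIV. w $ i * L2_inner D (r i) (C0 P ?q))"
    using assms by (simp add: inner_vec_def Rmat_mult_nth)
  also have "\<dots> = L2_inner D ?q (C0 P ?q)"
    using assms C0_L2[OF q] by (intro L2_inner_sum_left[symmetric])
  finally show ?thesis
    using C0_nonneg[OF q] by simp
qed

lemma Rmat_noise_invertible:
  assumes "\<And>i. r i \<in> L2 D" "0 < c"
  shows "invertible (Rmat P r + c *\<^sub>R noise_cov P)"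
proof (rule invertible_posdef)
  fix w :: "real^'m" assume "w \<noteq> 0"
  then have "0 < c * (w \<bullet> (noise_cov P *v w))"
    using noise(2) assms(2) by simp
  then show "0 < w \<bullet> ((Rmat P r + c *\<^sub>R noise_cov P) *v w)"
    using Rmat_nonneg[of r w] assms(1)
    by (simp add: matrix_vector_mult_add_rdistrib inner_add_right flip: scaleR_matrix_vector_assoc)
qed

section \<open>The Levenberg--Marquardt step\<close>

text \<open>Completing the square.  At the proposed step \<open>h\<close> the residual is \<open>(1 + \<alpha>) \<Sigma> a\<close> by the linear
  system for \<open>a\<close>, so the misfit has slope \<open>-(1 + \<alpha>) a \<bullet> A g\<close> in direction \<open>g\<close>.  The Riesz representation gives the two
  penalties together the opposite slope.  What remains of the objective around \<open>h\<close> is a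
  nonnegative form plus \<open>(1 + \<alpha>)/2 \<parallel>g\<parallel>\<^sup>2\<close>.\<close>

lemma LM_objective_around_step:
  assumes u: "u \<in> CM P" and \<alpha>: "0 \<le> \<alpha>" and A: "has_CM_derivative P (forward P) u A"
    and r: "\<And>i. r i \<in> L2 D" and Ar: "\<forall>h\<in>CM P. \<forall>i. A h $ i = L2_inner D (r i) h"
    and a: "(Rmat P r + (1 + \<alpha>) *\<^sub>R noise_cov P) *v a =
      observation P - forward P u - A (\<lambda>x. (prior_mean P x - u x) / (1 + \<alpha>))"
    and h_def: "h = (\<lambda>x. (prior_mean P x - u x) / (1 + \<alpha>) + (\<Sum>i\<in>UNIV. a $ i * C0 P (r i) x))"
  shows "h \<in> CM P"
    and "g \<in> CM P \<Longrightarrow> LM_objective P u A \<alpha> (\<lambda>x. h x + g x) =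
      LM_objective P u A \<alpha> h + noise_norm_sq P (A g) / 2 + (1 + \<alpha>) / 2 * (CM_norm P g)\<^sup>2"
proof -
  let ?q = "\<lambda>x. \<Sum>i\<in>UNIV. a $ i * r i x"
  let ?b = "\<lambda>x. (prior_mean P x - u x) / (1 + \<alpha>)"
  have q: "?q \<in> L2 D"
    using r by (intro L2_sum)
  have b: "?b \<in> CM P"
    using CM_lincomb[OF mean u, of "1 / (1 + \<alpha>)" "- 1 / (1 + \<alpha>)"] by (simp add: diff_divide_distrib)
  have h_eq: "h = (\<lambda>x. 1 * ?b x + 1 * C0 P ?q x)"
    using r by (simp add: h_def C0_sum)
  show h: "h \<in> CM P"
    unfolding h_eq using b C0_CM[OF q] by (rule CM_lincomb)
  have A_lincomb: "A (\<lambda>x. s * f x + t * g x) = s *\<^sub>R A f + t *\<^sub>R A g"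
    if "f \<in> CM P" "g \<in> CM P" for f g s t
    using A that by (simp add: has_CM_derivative_def)
  have "A (C0 P ?q) = Rmat P r *v a"
    using r by (simp add: vec_eq_iff Ar C0_CM[OF q] Rmat_mult_nth)
  then have "A h = A ?b + Rmat P r *v a"
    unfolding h_eq using A_lincomb[OF b C0_CM[OF q], of 1 1] by simp
  then have residual: "observation P - forward P u - A h = (1 + \<alpha>) *\<^sub>R (noise_cov P *v a)"
    using a by (simp add: matrix_vector_mult_add_rdistrib scaleR_matrix_vector_assoc algebra_simps)
  then have weighted_residual:
    "matrix_inv (noise_cov P) *v (observation P - forward P u - A h) = (1 + \<alpha>) *\<^sub>R a"
    by (simp add: matrix_vector_mult_scaleR noise_inv_mult)
  assume g: "g \<in> CM P"
  let ?k = "\<lambda>x. u x + h x - prior_mean P x"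
  \<comment> \<open>The term \<open>u - m\<close>, for prior mean \<open>m\<close>, is \<open>-(1 + \<alpha>)\<close> times the first part \<open>?b\<close> of the step, so the
    slope \<open>\<langle>?k, g\<rangle> + \<alpha> \<langle>h, g\<rangle>\<close> of the penalties is \<open>(1 + \<alpha>) \<langle>h - ?b, g\<rangle>\<close>.\<close>
  have k_eq: "?k = (\<lambda>x. 1 * h x + - (1 + \<alpha>) * ?b x)"
    using \<alpha> by (simp add: fun_eq_iff field_simps)
  have k: "?k \<in> CM P"
    unfolding k_eq using h b by (rule CM_lincomb)
  have misfit: "noise_norm_sq P (observation P - forward P u - A (\<lambda>x. h x + g x)) =
      noise_norm_sq P (observation P - forward P u - A h) - 2 * (1 + \<alpha>) * (a \<bullet> A g)
      + noise_norm_sq P (A g)"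
  proof -
    have "observation P - forward P u - A (\<lambda>x. h x + g x) =
        observation P - forward P u - A h - A g"
      using A_lincomb[OF h g, of 1 1] by simp
    then show ?thesis
      by (simp only: noise_norm_sq_diff[of "observation P - forward P u - A h" "A g"]
          weighted_residual inner_scaleR_left mult.assoc)
  qed
  have prior: "(CM_norm P (\<lambda>x. u x + (h x + g x) - prior_mean P x))\<^sup>2 =
      (CM_norm P ?k)\<^sup>2 + 2 * CM_inner P ?k g + (CM_norm P g)\<^sup>2"
    using CM_norm_sq_add[OF k g] by (simp add: algebra_simps)
  have "CM_inner P (C0 P ?q) g = (\<Sum>i\<in>UNIV. a $ i * L2_inner D (r i) g)"
    using r CM_inner_C0[OF q g] CM_L2[OF g] by (simp add: L2_inner_sum_left)
  also have "\<dots> = a \<bullet> A g"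
    using g by (simp add: inner_vec_def Ar)
  finally have h_inner: "CM_inner P h g = CM_inner P ?b g + a \<bullet> A g"
    unfolding h_eq using CM_inner_lincomb_left[OF b C0_CM[OF q] g, of 1 1] by simp
  have k_inner: "CM_inner P ?k g = CM_inner P h g - (1 + \<alpha>) * CM_inner P ?b g"
    unfolding k_eq CM_inner_lincomb_left[OF h b g] by (simp add: algebra_simps)
  show "LM_objective P u A \<alpha> (\<lambda>x. h x + g x) =
      LM_objective P u A \<alpha> h + noise_norm_sq P (A g) / 2 + (1 + \<alpha>) / 2 * (CM_norm P g)\<^sup>2"
    unfolding LM_objective_def misfit prior CM_norm_sq_add[OF h g] k_inner h_inner
    by (simp add: field_simps)
qed

text \<open>By the completed square the objective exceeds its value at the step by at least half the
  squared distance, measured in the Cameron--Martin norm; this gives both minimality and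
  uniqueness.\<close>

lemma LM_step_unique_minimiser:
  assumes u: "u \<in> CM P" and \<alpha>: "0 \<le> \<alpha>" and A: "has_CM_derivative P (forward P) u A"
    and r: "\<And>i. r i \<in> L2 D" and Ar: "\<forall>h\<in>CM P. \<forall>i. A h $ i = L2_inner D (r i) h"
    and a: "(Rmat P r + (1 + \<alpha>) *\<^sub>R noise_cov P) *v a =
      observation P - forward P u - A (\<lambda>x. (prior_mean P x - u x) / (1 + \<alpha>))"
  shows "unique_minimiser_on (CM P) (LM_objective P u A \<alpha>)
      (\<lambda>x. (prior_mean P x - u x) / (1 + \<alpha>) + (\<Sum>i\<in>UNIV. a $ i * C0 P (r i) x))"
proof -
  define h where "h = (\<lambda>x. (prior_mean P x - u x) / (1 + \<alpha>) + (\<Sum>i\<in>UNIV. a $ i * C0 P (r i) x))"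
  note around = LM_objective_around_step[OF assms h_def]
  have diff: "(\<lambda>x. k x - h x) \<in> CM P" if "k \<in> CM P" for k
    using CM_lincomb[OF that around(1), of 1 "-1"] by simp
  have gap: "(CM_norm P (\<lambda>x. k x - h x))\<^sup>2 / 2 \<le> LM_objective P u A \<alpha> k - LM_objective P u A \<alpha> h"
    if "k \<in> CM P" for k
  proof -
    have "1 * (CM_norm P (\<lambda>x. k x - h x))\<^sup>2 \<le> (1 + \<alpha>) * (CM_norm P (\<lambda>x. k x - h x))\<^sup>2"
      using \<alpha> by (intro mult_right_mono) auto
    then show ?thesis
      using around(2)[OF diff[OF that]] noise_norm_sq_nonneg[of "A (\<lambda>x. k x - h x)"] by simp
  qed
  have "unique_minimiser_on (CM P) (LM_objective P u A \<alpha>) h"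
    unfolding unique_minimiser_on_def
  proof (intro conjI ballI impI)
    show "h \<in> CM P"
      by (rule around(1))
    show "LM_objective P u A \<alpha> h \<le> LM_objective P u A \<alpha> k" if "k \<in> CM P" for k
      using gap[OF that] zero_le_power2[of "CM_norm P (\<lambda>x. k x - h x)"] by linarith
    fix k
    assume k: "k \<in> CM P" "\<forall>g\<in>CM P. LM_objective P u A \<alpha> k \<le> LM_objective P u A \<alpha> g"
    then have "(CM_norm P (\<lambda>x. k x - h x))\<^sup>2 \<le> 0"
      using gap[OF k(1)] bspec[OF k(2) around(1)] by linarith
    then have "(\<lambda>x. k x - h x) = (\<lambda>x. 0)"
      using diff[OF k(1)] by (intro CM_norm_eq_0D) auto
    then show "k = h"
      by (simp add: fun_eq_iff)
  qed
  then show ?thesis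
    by (simp add: h_def)
qed

section \<open>The Gauss--Newton covariance\<close>

text \<open>Pairing with the \<open>r i\<close> is a bounded linear extension of \<open>A\<close>, so the choice in the definition
  is made from a nonempty class.  Every member of that class agrees with this pairing on all of L2,
  by continuity and density of the Cameron--Martin space.\<close>

lemma L2_extension_nth:
  assumes r: "\<And>i. r i \<in> L2 D" and Ar: "\<forall>h\<in>CM P. \<forall>i. A h $ i = L2_inner D (r i) h"
    and f: "f \<in> L2 D"
  shows "L2_extension P A f $ i = L2_inner D (r i) f"
proof -
  let ?ext = "\<lambda>B. (\<forall>f\<in>L2 D. \<forall>g\<in>L2 D. \<forall>a b.
      B (\<lambda>x. a * f x + b * g x) = a *\<^sub>R B f + b *\<^sub>R B g) \<and>
    (\<exists>C. \<forall>f\<in>L2 D. norm (B f) \<le> C * L2_norm D f) \<and> (\<forall>h\<in>CM P. B h = A h)"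
  let ?B = "\<lambda>f. \<chi> i. L2_inner D (r i) f"
  have "?ext ?B"
  proof (intro conjI ballI allI)
    show "?B (\<lambda>x. a * f x + b * g x) = a *\<^sub>R ?B f + b *\<^sub>R ?B g"
      if "f \<in> L2 D" "g \<in> L2 D" for f g a b
      using that r by (simp add: vec_eq_iff L2_inner_lincomb_right)
    have "norm (?B f) \<le> (\<Sum>i\<in>UNIV. L2_norm D (r i)) * L2_norm D f" if "f \<in> L2 D" for f
    proof -
      have "norm (?B f) \<le> (\<Sum>i\<in>UNIV. \<bar>?B f $ i\<bar>)"
        by (rule norm_le_l1_cart)
      also have "\<dots> \<le> (\<Sum>i\<in>UNIV. L2_norm D (r i) * L2_norm D f)"
        using r that by (intro sum_mono) (simp add: L2_Cauchy_Schwarz)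
      finally show ?thesis
        by (simp add: sum_distrib_right)
    qed
    then show "\<exists>C. \<forall>f\<in>L2 D. norm (?B f) \<le> C * L2_norm D f"
      by blast
    show "?B h = A h" if "h \<in> CM P" for h
      using that by (simp add: vec_eq_iff Ar)
  qed
  then have "?ext (L2_extension P A)"
    unfolding L2_extension_def by (rule someI[where P = ?ext])
  then obtain C where lin: "\<And>f g a b. f \<in> L2 D \<Longrightarrow> g \<in> L2 D \<Longrightarrow>
      L2_extension P A (\<lambda>x. a * f x + b * g x) = a *\<^sub>R L2_extension P A f + b *\<^sub>R L2_extension P A g"
    and bound: "\<And>f. f \<in> L2 D \<Longrightarrow> norm (L2_extension P A f) \<le> C * L2_norm D f"
    and CM: "\<And>h. h \<in> CM P \<Longrightarrow> L2_extension P A h = A h"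
    by blast
  obtain p where p: "\<And>N. p N \<in> CM P" "(\<lambda>N. L2_norm D (\<lambda>x. p N x - f x)) \<longlonglongrightarrow> 0"
    using CM_dense[OF f] by blast
  have p_L2: "(\<lambda>x. p N x - f x) \<in> L2 D" for N
    using CM_L2[OF p(1)] f by (rule L2_diff)
  have 1: "(\<lambda>N. L2_inner D (r i) (p N) - L2_extension P A f $ i) \<longlonglongrightarrow> 0"
  proof (rule tendsto_0_le[OF p(2), where K = C], intro always_eventually allI)
    fix N
    have "L2_inner D (r i) (p N) - L2_extension P A f $ i =
        L2_extension P A (\<lambda>x. p N x - f x) $ i"
      using lin[OF CM_L2[OF p(1)[of N]] f, of 1 "-1"] by (simp add: CM p(1) Ar)
    then show "norm (L2_inner D (r i) (p N) - L2_extension P A f $ i)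
        \<le> norm (L2_norm D (\<lambda>x. p N x - f x)) * C"
      using bound[OF p_L2[of N]] component_le_norm_cart[of "L2_extension P A (\<lambda>x. p N x - f x)" i]
      by (simp add: L2_norm_nonneg mult.commute)
  qed
  have 2: "(\<lambda>N. L2_inner D (r i) (p N) - L2_inner D (r i) f) \<longlonglongrightarrow> 0"
  proof (rule tendsto_0_le[OF p(2), where K = "L2_norm D (r i)"], intro always_eventually allI)
    fix N
    have "L2_inner D (r i) (p N) - L2_inner D (r i) f = L2_inner D (r i) (\<lambda>x. p N x - f x)"
      using L2_inner_lincomb_right[OF CM_L2[OF p(1)[of N]] f r[of i], of 1 "-1"] by simp
    then show "norm (L2_inner D (r i) (p N) - L2_inner D (r i) f)
        \<le> norm (L2_norm D (\<lambda>x. p N x - f x)) * L2_norm D (r i)"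
      using L2_Cauchy_Schwarz[OF r[of i] p_L2[of N]] by (simp add: L2_norm_nonneg mult.commute)
  qed
  show ?thesis
    using LIM_zero_cancel[OF 1] LIM_zero_cancel[OF 2] by (rule LIMSEQ_unique)
qed

text \<open>The adjoint is a choice of representatives, hence only known up to null sets; applying the
  covariance afterwards removes the ambiguity.\<close>

lemma L2_adjoint_AE:
  assumes r: "\<And>i. r i \<in> L2 D" and B: "\<forall>f\<in>L2 D. \<forall>i. B f $ i = L2_inner D (r i) f"
  shows "L2_adjoint P B w \<in> L2 D"
    and "AE x in lebesgue_on D. L2_adjoint P B w x = (\<Sum>i\<in>UNIV. w $ i * r i x)"
proof -
  let ?adj = "\<lambda>B'. \<forall>w. B' w \<in> L2 D \<and> (\<forall>v\<in>L2 D. L2_inner D (B' w) v = w \<bullet> B v)"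
  let ?B' = "\<lambda>w x. \<Sum>i\<in>UNIV. w $ i * r i x"
  have adj': "?adj ?B'"
    using r by (auto simp: L2_sum L2_inner_sum_left B inner_vec_def)
  then have adj: "?adj (L2_adjoint P B)"
    unfolding L2_adjoint_def by (rule someI[where P = ?adj])
  then show "L2_adjoint P B w \<in> L2 D"
    by blast
  show "AE x in lebesgue_on D. L2_adjoint P B w x = ?B' w x"
    by (rule orthonormal_basis_eqI[OF eigenbasis]) (use adj adj' e_L2 in simp_all)
qed

lemma C0_L2_adjoint_L2_extension:
  assumes r: "\<And>i. r i \<in> L2 D" and Ar: "\<forall>h\<in>CM P. \<forall>i. A h $ i = L2_inner D (r i) h"
  shows "C0 P (L2_adjoint P (L2_extension P A) w) = C0 P (\<lambda>x. \<Sum>i\<in>UNIV. w $ i * r i x)"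
proof (rule C0_cong_AE)
  have "\<forall>f\<in>L2 D. \<forall>i. L2_extension P A f $ i = L2_inner D (r i) f"
    using L2_extension_nth[where r = r, OF r Ar] by blast
  with r show "AE x in lebesgue_on D.
      L2_adjoint P (L2_extension P A) w x = (\<Sum>i\<in>UNIV. w $ i * r i x)"
    and "L2_adjoint P (L2_extension P A) w \<in> L2 D"
    by (rule L2_adjoint_AE)+
  show "(\<lambda>x. \<Sum>i\<in>UNIV. w $ i * r i x) \<in> L2 D"
    using r by (intro L2_sum)
qed

lemma GN_data_op_eq:
  assumes r: "\<And>i. r i \<in> L2 D" and Ar: "\<forall>h\<in>CM P. \<forall>i. A h $ i = L2_inner D (r i) h"
  shows "GN_data_op P A w = (Rmat P r + noise_cov P) *v w"
proof -
  let ?q = "\<lambda>x. \<Sum>i\<in>UNIV. w $ i * r i x"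
  have "C0 P ?q \<in> L2 D"
    using r by (intro C0_L2 L2_sum)
  then have "L2_extension P A (C0 P ?q) = Rmat P r *v w"
    by (simp add: vec_eq_iff L2_extension_nth[where r = r, OF r Ar] Rmat_mult_nth r)
  then show ?thesis
    by (simp add: GN_data_op_def C0_L2_adjoint_L2_extension[where r = r, OF r Ar]
        matrix_vector_mult_add_rdistrib)
qed

lemma
  assumes r: "\<And>i. r i \<in> L2 D" and Ar: "\<forall>h\<in>CM P. \<forall>i. A h $ i = L2_inner D (r i) h"
  shows bij_GN_data_op: "bij (GN_data_op P A)"
    and inv_GN_data_op: "inv (GN_data_op P A) w = matrix_inv (Rmat P r + noise_cov P) *v w"
proof -
  let ?M = "Rmat P r + noise_cov P"
  have M: "invertible ?M"
    using Rmat_noise_invertible[where c = 1, OF r] by simp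
  have op: "GN_data_op P A = (\<lambda>w. ?M *v w)"
    using GN_data_op_eq[where r = r, OF r Ar] by blast
  show bij: "bij (GN_data_op P A)"
    unfolding op
    by (rule o_bij[where g = "\<lambda>w. matrix_inv ?M *v w"])
      (simp_all add: fun_eq_iff matrix_inv_vector_mult[OF M])
  show "inv (GN_data_op P A) w = matrix_inv ?M *v w"
    using bij by (intro inv_f_eq bij_is_inj) (simp_all add: op matrix_inv_vector_mult[OF M])
qed

lemma C_MAP_eq:
  assumes r: "\<And>i. r i \<in> L2 D" and Ar: "\<forall>h\<in>CM P. \<forall>i. A h $ i = L2_inner D (r i) h"
    and v: "v \<in> L2 D"
  defines "c \<equiv> matrix_inv (Rmat P r + noise_cov P) *v (\<chi> j. L2_inner D (r j) (C0 P v))"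
  shows "C_MAP P A v = (\<lambda>x. C0 P v x - C0 P (\<lambda>z. \<Sum>i\<in>UNIV. c $ i * r i z) x)"
proof -
  have "L2_extension P A (C0 P v) = (\<chi> j. L2_inner D (r j) (C0 P v))"
    by (simp add: vec_eq_iff L2_extension_nth[where r = r, OF r Ar] C0_L2 v)
  then show ?thesis
    by (simp add: C_MAP_def Let_def inv_GN_data_op[where r = r, OF r Ar] c_def
        C0_L2_adjoint_L2_extension[where r = r, OF r Ar])
qed

text \<open>The functions spanning the correction are the \<open>C0 (r i)\<close>, whatever \<open>v\<close> is.\<close>

lemma C_MAP_rank:
  assumes r: "\<And>i. r i \<in> L2 D" and Ar: "\<forall>h\<in>CM P. \<forall>i. A h $ i = L2_inner D (r i) h"
  shows "L2_rank_le D CARD('m) (\<lambda>v x. C_MAP P A v x - C0 P v x)"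
proof -
  obtain \<pi> :: "nat \<Rightarrow> 'm" where \<pi>: "bij_betw \<pi> {..<CARD('m)} UNIV"
    using ex_bij_betw_nat_finite[of "UNIV :: 'm set"] by (auto simp: atLeast0LessThan)
  show ?thesis
    unfolding L2_rank_le_def
  proof (intro exI[of _ "\<lambda>k. C0 P (r (\<pi> k))"] conjI allI impI ballI)
    show "C0 P (r (\<pi> k)) \<in> L2 D" for k
      using r by (rule C0_L2)
    fix v assume v: "v \<in> L2 D"
    define c where "c = matrix_inv (Rmat P r + noise_cov P) *v (\<chi> j. L2_inner D (r j) (C0 P v))"
    have "C_MAP P A v x - C0 P v x = (\<Sum>k<CARD('m). - c $ \<pi> k * C0 P (r (\<pi> k)) x)" for x
    proof -
      have "C_MAP P A v x - C0 P v x = (\<Sum>i\<in>UNIV. - c $ i * C0 P (r i) x)"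
        using r C_MAP_eq[where r = r, OF r Ar v] by (simp add: C0_sum c_def sum_negf)
      also have "\<dots> = (\<Sum>k<CARD('m). - c $ \<pi> k * C0 P (r (\<pi> k)) x)"
        using \<pi> by (rule sum.reindex_bij_betw[symmetric])
      finally show ?thesis .
    qed
    then show "\<exists>c. AE x in lebesgue_on D. C_MAP P A v x - C0 P v x =
        (\<Sum>k<CARD('m). c k * C0 P (r (\<pi> k)) x)"
      by (intro exI[of _ "\<lambda>k. - c $ \<pi> k"] AE_I2)
  qed
qed

end

theorem theorem2p1:
  fixes P :: "('d::finite, 'm::finite) problem"
  assumes setting: "darcy_inverse_problem P"
  shows
    "(\<forall>u \<alpha> DG r.
        u \<in> CM P \<and> \<alpha> \<ge> 0 \<and>
        has_CM_derivative P (forward P) u DG \<and>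
        (\<forall>i. r i \<in> L2 (dom P)) \<and>
        (\<forall>h\<in>CM P. \<forall>i. DG h $ i = L2_inner (dom P) (r i) h) \<longrightarrow>
        (let solves = (\<lambda>a. (Rmat P r + (1 + \<alpha>) *\<^sub>R noise_cov P) *v a =
               observation P - forward P u - DG (\<lambda>x. (prior_mean P x - u x) / (1 + \<alpha>)))
         in (\<exists>a. solves a) \<and>
            (\<forall>a. solves a \<longrightarrow>
               unique_minimiser_on (CM P) (LM_objective P u DG \<alpha>)
                 (\<lambda>x. (prior_mean P x - u x) / (1 + \<alpha>) + (\<Sum>i\<in>UNIV. a $ i * C0 P (r i) x))))) \<and>
     (\<forall>u DG r.
        stationary_OM P u \<and>
        has_CM_derivative P (forward P) u DG \<and>
        (\<forall>i. r i \<in> L2 (dom P)) \<and>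
        (\<forall>h\<in>CM P. \<forall>i. DG h $ i = L2_inner (dom P) (r i) h) \<longrightarrow>
        bij (GN_data_op P DG) \<and>
        invertible (Rmat P r + noise_cov P) \<and>
        (\<forall>v\<in>L2 (dom P).
           C_MAP P DG v = (\<lambda>x. C0 P v x -
             C0 P (\<lambda>z. \<Sum>i\<in>UNIV. \<Sum>j\<in>UNIV.
               r i z * matrix_inv (Rmat P r + noise_cov P) $ i $ j *
               L2_inner (dom P) (r j) (C0 P v)) x)) \<and>
        L2_rank_le (dom P) CARD('m) (\<lambda>v x. C_MAP P DG v x - C0 P v x))"
proof -
  interpret darcy_inverse_problem P
    by (rule setting)
  show ?thesis
  proof (intro conjI allI impI, goal_cases)
    case (1 u \<alpha> DG r)
    then have "0 < 1 + \<alpha>" and r: "\<And>i. r i \<in> L2 (dom P)"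
      by auto
    then have "invertible (Rmat P r + (1 + \<alpha>) *\<^sub>R noise_cov P)"
      by (intro Rmat_noise_invertible)
    then have "\<exists>a. (Rmat P r + (1 + \<alpha>) *\<^sub>R noise_cov P) *v a = w" for w
      using matrix_inv_vector_mult(2) by blast
    with 1 show ?case
      unfolding Let_def by (intro conjI allI impI LM_step_unique_minimiser) auto
  next
    case (2 u DG r)
    then have r: "\<And>i. r i \<in> L2 (dom P)"
      and DG: "\<forall>h\<in>CM P. \<forall>i. DG h $ i = L2_inner (dom P) (r i) h"
      by auto
    show ?case
      using r DG by (rule bij_GN_data_op)
  next
    case (3 u DG r)
    then show ?case
      using Rmat_noise_invertible[of r 1] by simp
  next
    case (4 u DG r)
    then have r: "\<And>i. r i \<in> L2 (dom P)"
      and DG: "\<forall>h\<in>CM P. \<forall>i. DG h $ i = L2_inner (dom P) (r i) h"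
      by auto
    show ?case
      by (simp add: C_MAP_eq[where r = r, OF r DG] matrix_vector_mult_def sum_distrib_left
          sum_distrib_right mult_ac)
  next
    case (5 u DG r)
    then have r: "\<And>i. r i \<in> L2 (dom P)"
      and DG: "\<forall>h\<in>CM P. \<forall>i. DG h $ i = L2_inner (dom P) (r i) h"
      by auto
    show ?case
      using r DG by (rule C_MAP_rank)
  qed
qed

end
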